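(* Let $0<q<1$ and $a,b\in\mathbb{R}$. The power series $$\sum_{m=0}^\infty \frac{t^m}{m!}\prod_{j=0}^{m-1}\left(a+bq^j\right)$$ is convergent for every $t\in\mathbb{R}$.
   Context: The empty product (for $m=0$) equals $1$. The series is the one obtained by successive approximation for the pantograph equation $y'(t)=ay(t)+by(qt)$, $y(0)=1$. *)

theory Defs
  imports Complex_Main
begin

end

theory Submission imports Defs
begin

text \<open>Since the powers of q stay in [0, 1], every factor of the product is bounded by K = |a|
  + |b|, independently of j. The m-th term is therefore at most (K |t|)^m / m! in absolute value,
  and the exponential series at K |t| dominates the given one.\<close>

theorem theorem6:
  fixes q a b t :: real
  assumes "0 < q" and "q < 1"
  shows "summable (\<lambda>m::nat. t ^ m / fact m * (\<Prod>j = 0..<m. a + b * q ^ j))"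
proof (rule summable_comparison_test)
  let ?K = "\<bar>a\<bar> + \<bar>b\<bar>"
  have factor: "\<bar>a + b * q ^ j\<bar> \<le> ?K" for j
  proof -
    \<comment> \<open>The only place where 0 < q < 1 enters: it gives 0 \<le> q^j \<le> 1.\<close>
    have "\<bar>b * q ^ j\<bar> \<le> \<bar>b\<bar>"
      using assms by (simp add: abs_mult power_le_one mult_left_le)
    then show ?thesis by linarith
  qed
  \<comment> \<open>The majorant is written with \<open>inverse (fact m)\<close> so that it is
    literally the series of \<open>summable_exp\<close>.\<close>
  have "norm (t ^ m / fact m * (\<Prod>j = 0..<m. a + b * q ^ j)) \<le> inverse (fact m) * (?K * \<bar>t\<bar>) ^ m"
    for m :: nat
  proof -
    have "\<bar>\<Prod>j = 0..<m. a + b * q ^ j\<bar> \<le> (\<Prod>j = 0..<m. ?K)"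
      unfolding abs_prod by (rule prod_mono) (use factor in auto)
    then have "\<bar>t\<bar> ^ m / fact m * \<bar>\<Prod>j = 0..<m. a + b * q ^ j\<bar> \<le> \<bar>t\<bar> ^ m / fact m * ?K ^ m"
      by (intro mult_left_mono) auto
    then show ?thesis
      by (simp add: abs_mult power_abs power_mult_distrib divide_inverse mult_ac)
  qed
  then show "\<exists>N. \<forall>m\<ge>N. norm (t ^ m / fact m * (\<Prod>j = 0..<m. a + b * q ^ j))
      \<le> inverse (fact m) * (?K * \<bar>t\<bar>) ^ m"
    by blast
  show "summable (\<lambda>m. inverse (fact m) * (?K * \<bar>t\<bar>) ^ m)"
    by (rule summable_exp)
qed

end
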